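(* Let $n\ge 2$. Suppose that $\nu$ is a probability measure on $\mathbb{S}^n_+$ with a density of the form $d\nu(x) = f(d(x,N))\,d\sigma_+(x)$, where $f:[0,\pi/2]\to(0,\infty)$ is some positive continuous function. Then the $W_2$ optimal transport map between $\sigma_+$ and $\nu$ is $1$-Lipschitz if and only if $\nu=\sigma_+$.
   Context: $\mathbb{S}^n$ is the unit Euclidean sphere of $\mathbb{R}^{n+1}$, equipped with its geodesic distance $d=d_{\mathbb{S}^n}$, $d(x,y)=\arccos(x\cdot y)$. $\mathbb{S}^n_+=\{x\in\mathbb{S}^n: x_{n+1}\ge 0\}$ is the closed upper hemisphere, $N=(0,\ldots,0,1)$ is the north pole, and $\sigma_+$ is the uniform probability measure on $\mathbb{S}^n_+$. For probability measures $\mu,\nu$ on $\mathbb{S}^n$, $W_2^2(\mu,\nu)=\inf_{\pi\in\Pi(\mu,\nu)}\int d^2(x,y)\,d\pi(x,y)$, where $\Pi(\mu,\nu)$ is the set of couplings of $\mu$ and $\nu$. When $\mu$ is absolutely continuous with respect to the uniform measure on $\mathbb{S}^n$, there is a $\mu$-almost surely unique map $T$ (McCann's theorem), called the $W_2$ optimal transport map from $\mu$ to $\nu$, with $T_\#\mu=\nu$ and $\int d^2(x,T(x))\,d\mu(x)=W_2^2(\mu,\nu)$. Since this map is only determined up to $\mu$-null sets, "the optimal transport map between $\sigma_+$ and $\nu$ is $1$-Lipschitz" means that it agrees $\sigma_+$-almost everywhere with a map $\mathbb{S}^n_+\to\mathbb{S}^n_+$ that is $1$-Lipschitz for $d$.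 *)

theory Defs
  imports "HOL-Probability.Probability"
begin

text \<open>
  We realise \<open>\<real>\<^bsup>n+1\<^esup>\<close> as \<open>(real ^ 'n) \<times> real\<close> with \<open>n = CARD('n)\<close>; the library norm and inner
  product on this type are the Euclidean ones, and \<^const>\<open>snd\<close> is the last coordinate.
\<close>

definition geodesic_dist :: "'a::real_inner \<Rightarrow> 'a \<Rightarrow> real" where
  "geodesic_dist x y = arccos (inner x y)"

definition north_pole :: "(real ^ 'n) \<times> real" where
  "north_pole = (0, 1)"

definition upper_hemisphere :: "((real ^ 'n) \<times> real) set" where
  "upper_hemisphere = {x \<in> sphere 0 1. snd x \<ge> 0}"

text \<open>
  The uniform probability measure on the unit sphere, on the Borel sets of the sphere, as the
  normalised cone measure: the law of \<open>x / norm x\<close> for \<open>x\<close> uniform in the unit ball. The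
  origin, where \<^const>\<open>sgn\<close> is \<open>0\<close> and so leaves the sphere, is Lebesgue-null.
\<close>

definition uniform_sphere :: "'a::euclidean_space measure" where
  "uniform_sphere =
     restrict_space (distr (uniform_measure lborel (ball 0 1)) borel sgn) (sphere 0 1)"

definition uniform_hemisphere :: "((real ^ 'n) \<times> real) measure" where
  "uniform_hemisphere = uniform_measure uniform_sphere upper_hemisphere"

text \<open>
  The marginal conditions make a coupling of probability measures a probability measure.
\<close>

definition couplings :: "'a measure \<Rightarrow> 'b measure \<Rightarrow> ('a \<times> 'b) measure set" where
  "couplings \<mu> \<nu> =
     {\<pi>. sets \<pi> = sets (\<mu> \<Otimes>\<^sub>M \<nu>) \<and> distr \<pi> \<mu> fst = \<mu> \<and> distr \<pi> \<nu> snd = \<nu>}"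

definition W2_squared :: "'a::real_inner measure \<Rightarrow> 'a measure \<Rightarrow> ennreal" where
  "W2_squared \<mu> \<nu> =
     (INF \<pi>\<in>couplings \<mu> \<nu>. \<integral>\<^sup>+(x, y). ennreal ((geodesic_dist x y)\<^sup>2) \<partial>\<pi>)"

definition optimal_transport_map ::
  "'a::real_inner measure \<Rightarrow> 'a measure \<Rightarrow> ('a \<Rightarrow> 'a) \<Rightarrow> bool" where
  "optimal_transport_map \<mu> \<nu> T \<longleftrightarrow>
     T \<in> measurable \<mu> \<nu> \<and> distr \<mu> \<nu> T = \<nu> \<and>
     (\<integral>\<^sup>+x. ennreal ((geodesic_dist x (T x))\<^sup>2) \<partial>\<mu>) = W2_squared \<mu> \<nu>"

definition ae_1_lipschitz :: "((real ^ 'n) \<times> real \<Rightarrow> (real ^ 'n) \<times> real) \<Rightarrow> bool" where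
  "ae_1_lipschitz T \<longleftrightarrow>
     (\<exists>S. S \<in> upper_hemisphere \<rightarrow> upper_hemisphere \<and>
          (\<forall>x\<in>upper_hemisphere. \<forall>y\<in>upper_hemisphere.
             geodesic_dist (S x) (S y) \<le> geodesic_dist x y) \<and>
          (AE x in uniform_hemisphere. T x = S x))"

end

theory Submission
  imports Defs
begin

text \<open>
  Let \<open>T\<close> be almost everywhere equal to a 1-Lipschitz map \<open>S\<close>. Since \<open>T\<close> transports \<open>\<sigma>\<^sub>+\<close> to \<open>\<nu>\<close>,
  the measure \<open>\<nu>\<close> is concentrated on the compact set \<open>S(\<S>\<^sup>n\<^sub>+)\<close>. As \<open>f > 0\<close>, it also charges every
  nonempty relatively open subset of the hemisphere (by \<open>uniform_hemisphere_ball_pos\<close>), so \<open>S\<close> is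
  onto. A nonexpansive map of a compact metric space onto itself is an isometry
  (\<open>nonexpansive_onto_compact_isometry\<close>), and an isometry of the hemisphere fixes the north pole,
  the only point within distance \<open>\<pi>/2\<close> of all the others (\<open>hemisphere_isometry_fixes_pole\<close>).

  Hence \<open>S\<close> preserves the polar angle \<open>h(x) = d(x,N)\<close>, and \<open>\<nu>\<close> and \<open>\<sigma>\<^sub>+\<close> have the same image
  \<open>m\<close> under \<open>h\<close>. The image of \<open>\<nu>\<close> is also \<open>f m\<close>, because the density of \<open>\<nu>\<close> is a function of
  \<open>h\<close>. So \<open>f = 1\<close> holds \<open>m\<close>-almost everywhere, which says \<open>\<nu> = \<sigma>\<^sub>+\<close>.

  Conversely, if \<open>\<nu> = \<sigma>\<^sub>+\<close> then the diagonal coupling has cost \<open>0\<close>, so an optimal map moves almost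
  no point.
\<close>

section \<open>Nonexpansive maps of a compact metric space onto itself\<close>

text \<open>
  By sequential compactness an orbit in \<open>K\<close> has a Cauchy subsequence. Taking it for the orbit of
  the pair in \<open>K \<times> K\<close> gives two times that work for both points at once.
\<close>

lemma orbit_pair_close:
  fixes R :: "'a::metric_space \<Rightarrow> 'a"
  assumes "compact K" "R \<in> K \<rightarrow> K" "x \<in> K" "y \<in> K" "e > 0"
  obtains j m where "m > 0"
    "dist ((R ^^ j) x) ((R ^^ (j + m)) x) < e" "dist ((R ^^ j) y) ((R ^^ (j + m)) y) < e"
proof -
  define s where "s k = ((R ^^ k) x, (R ^^ k) y)" for k
  have in_K: "(R ^^ k) z \<in> K" if "z \<in> K" for k z
    using assms(2) that by (induction k) auto
  have "\<forall>k. s k \<in> K \<times> K"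
    using in_K assms(3,4) by (auto simp: s_def)
  moreover have "seq_compact (K \<times> K)"
    using assms(1) by (intro compact_imp_seq_compact compact_Times)
  ultimately obtain l r where r: "strict_mono r" "(s \<circ> r) \<longlonglongrightarrow> l"
    by (metis seq_compactE)
  from r(2) have "Cauchy (s \<circ> r)"
    by (rule LIMSEQ_imp_Cauchy)
  then obtain k where k: "\<forall>a\<ge>k. \<forall>b\<ge>k. dist ((s \<circ> r) a) ((s \<circ> r) b) < e"
    using \<open>e > 0\<close> unfolding Cauchy_def by metis
  have less: "r k < r (Suc k)"
    using r(1) by (simp add: strict_mono_Suc_iff)
  have close: "dist (s (r k)) (s (r (Suc k))) < e"
    using k by simp
  show ?thesis
  proof (rule that)
    show "r (Suc k) - r k > 0"
      using less by simp
    show "dist ((R ^^ r k) x) ((R ^^ (r k + (r (Suc k) - r k))) x) < e"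
      using le_less_trans[OF dist_fst_le close] less by (simp add: s_def)
    show "dist ((R ^^ r k) y) ((R ^^ (r k + (r (Suc k) - r k))) y) < e"
      using le_less_trans[OF dist_snd_le close] less by (simp add: s_def)
  qed
qed

text \<open>
  A right inverse \<open>R\<close> of \<open>S\<close> does not decrease distances, so if \<open>R\<^sup>j x\<close> and \<open>R\<^bsup>j+m\<^esup> x\<close> are close,
  then so are \<open>x\<close> and \<open>R\<^sup>m x\<close>, and likewise for \<open>y\<close>. Up to a small error \<open>S x\<close> and \<open>S y\<close> are
  therefore \<open>S (R\<^sup>m x) = R\<^bsup>m-1\<^esup> x\<close> and \<open>R\<^bsup>m-1\<^esup> y\<close>, which are at least as far apart as \<open>x\<close> and \<open>y\<close>.
\<close>

lemma nonexpansive_onto_compact_isometry: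
  fixes S :: "'a::metric_space \<Rightarrow> 'a"
  assumes "compact K" and onto: "S ` K = K"
    and nonexp: "\<And>x y. x \<in> K \<Longrightarrow> y \<in> K \<Longrightarrow> dist (S x) (S y) \<le> dist x y"
    and "x \<in> K" "y \<in> K"
  shows "dist (S x) (S y) = dist x y"
proof (rule antisym)
  show "dist (S x) (S y) \<le> dist x y"
    using assms by auto
  define R where "R = inv_into K S"
  have R: "R z \<in> K" "S (R z) = z" if "z \<in> K" for z
    using that onto unfolding R_def by (metis inv_into_into, metis f_inv_into_f)
  have Rn: "(R ^^ k) z \<in> K" if "z \<in> K" for k z
    using R that by (induction k) auto
  have expand: "dist u v \<le> dist ((R ^^ k) u) ((R ^^ k) v)" if "u \<in> K" "v \<in> K" for u v k
  proof (induction k)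
    case (Suc k)
    also have "dist ((R ^^ k) u) ((R ^^ k) v) \<le> dist ((R ^^ Suc k) u) ((R ^^ Suc k) v)"
      using nonexp[of "R ((R ^^ k) u)" "R ((R ^^ k) v)"] R Rn that by simp
    finally show ?case .
  qed simp
  show "dist x y \<le> dist (S x) (S y)"
  proof (rule field_le_epsilon)
    fix e :: real assume "e > 0"
    then obtain j m where m: "m > 0"
      and "dist ((R ^^ j) x) ((R ^^ (j + m)) x) < e / 2"
        "dist ((R ^^ j) y) ((R ^^ (j + m)) y) < e / 2"
      using orbit_pair_close[of K R x y "e / 2"] assms(1,4,5) R(1)
      by (metis Pi_I half_gt_zero)
    then have ret: "dist x ((R ^^ m) x) < e / 2" "dist y ((R ^^ m) y) < e / 2"
      using expand[of x "(R ^^ m) x" j] expand[of y "(R ^^ m) y" j] Rn assms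
      by (auto simp: funpow_add)
    obtain k where k: "m = Suc k"
      using m gr0_implies_Suc by blast
    have "dist x y \<le> dist ((R ^^ k) x) ((R ^^ k) y)"
      using expand assms by simp
    also have "\<dots> = dist (S ((R ^^ m) x)) (S ((R ^^ m) y))"
      using R Rn assms by (simp add: k)
    also have "\<dots> \<le> dist (S ((R ^^ m) x)) (S x) + dist (S x) (S y)
        + dist (S y) (S ((R ^^ m) y))"
      by (smt (verit) dist_triangle)
    also have "\<dots> \<le> dist ((R ^^ m) x) x + dist (S x) (S y) + dist y ((R ^^ m) y)"
      using nonexp Rn assms by (intro add_mono) auto
    also have "\<dots> \<le> dist (S x) (S y) + e"
      using ret by (simp add: dist_commute)
    finally show "dist x y \<le> dist (S x) (S y) + e" .
  qed
qed

section \<open>Geometry of the hemisphere\<close>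

lemma sphere_inner_bounds:
  fixes x y :: "'a::real_inner"
  assumes "norm x = 1" "norm y = 1"
  shows "\<bar>inner x y\<bar> \<le> 1"
  using Cauchy_Schwarz_ineq2[of x y] assms by simp

text \<open>
  Both distances are strictly decreasing functions of the inner product; this lets metric facts
  about the ambient norm be used for the geodesic distance.
\<close>

lemma geodesic_dist_le_iff_dist_le:
  fixes x y u v :: "'a::real_inner"
  assumes "norm x = 1" "norm y = 1" "norm u = 1" "norm v = 1"
  shows "geodesic_dist x y \<le> geodesic_dist u v \<longleftrightarrow> dist x y \<le> dist u v"
proof -
  have "(dist a b)\<^sup>2 = 2 - 2 * inner a b" if "norm a = 1" "norm b = 1" for a b :: 'a
    using that
    by (simp add: dist_norm power2_norm_eq_inner norm_eq_1 inner_diff_left inner_diff_right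
        inner_commute)
  then have "dist x y \<le> dist u v \<longleftrightarrow> inner u v \<le> inner x y"
    using assms abs_le_square_iff[of "dist x y" "dist u v"] by simp
  then show ?thesis
    using assms by (simp add: geodesic_dist_def arccos_le_mono sphere_inner_bounds)
qed

lemma geodesic_dist_eq_0_iff:
  fixes x y :: "'a::real_inner"
  assumes "norm x = 1" "norm y = 1"
  shows "geodesic_dist x y = 0 \<longleftrightarrow> x = y"
proof -
  have "arccos (inner x y) = 0 \<longleftrightarrow> inner x y = 1"
    using sphere_inner_bounds[OF assms] by (intro arccos_eq_0_iff) auto
  also have "\<dots> \<longleftrightarrow> x = y"
    using assms norm_cauchy_schwarz_eq[of x y] by auto
  finally show ?thesis
    by (simp add: geodesic_dist_def)
qed

lemma compact_upper_hemisphere: "compact (upper_hemisphere :: ((real ^ 'n) \<times> real) set)"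
proof -
  have "closed {x :: (real ^ 'n) \<times> real. 0 \<le> snd x}"
    by (intro closed_Collect_le continuous_intros)
  then have "compact (sphere 0 1 \<inter> {x :: (real ^ 'n) \<times> real. 0 \<le> snd x})"
    by (intro compact_Int_closed) auto
  moreover have "sphere 0 1 \<inter> {x. 0 \<le> snd x} = (upper_hemisphere :: ((real ^ 'n) \<times> real) set)"
    by (auto simp: upper_hemisphere_def)
  ultimately show ?thesis
    by simp
qed

lemma north_pole_in_upper_hemisphere: "north_pole \<in> upper_hemisphere"
  by (auto simp: north_pole_def upper_hemisphere_def norm_Pair)

lemma inner_north_pole: "inner x north_pole = snd x"
  by (cases x) (simp add: north_pole_def)

text \<open>
  If the horizontal part \<open>v\<close> of a point were nonzero, the equatorial point opposite to \<open>v\<close> would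
  lie at distance more than \<open>\<pi>/2\<close>.
\<close>

lemma north_pole_unique:
  fixes p :: "(real ^ 'n) \<times> real"
  assumes "p \<in> upper_hemisphere"
    and "\<And>y. y \<in> upper_hemisphere \<Longrightarrow> inner p y \<ge> 0"
  shows "p = north_pole"
proof -
  obtain v z where p: "p = (v, z)"
    by (cases p)
  have "v = 0"
  proof (rule ccontr)
    assume "v \<noteq> 0"
    then have "(- sgn v, 0) \<in> (upper_hemisphere :: ((real ^ 'n) \<times> real) set)"
      by (simp add: upper_hemisphere_def norm_Pair norm_sgn)
    from assms(2)[OF this] have "inner v (sgn v) \<le> 0"
      by (simp add: p)
    moreover have "inner v (sgn v) = norm v"
      using \<open>v \<noteq> 0\<close> by (simp add: sgn_div_norm dot_square_norm power2_eq_square)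
    ultimately show False
      using \<open>v \<noteq> 0\<close> by simp
  qed
  then show ?thesis
    using assms(1) by (auto simp: p upper_hemisphere_def norm_Pair north_pole_def)
qed

lemma hemisphere_isometry_fixes_pole:
  fixes S :: "(real ^ 'n) \<times> real \<Rightarrow> (real ^ 'n) \<times> real"
  assumes onto: "S ` upper_hemisphere = upper_hemisphere"
    and iso: "\<And>x y. x \<in> upper_hemisphere \<Longrightarrow> y \<in> upper_hemisphere \<Longrightarrow>
      inner (S x) (S y) = inner x y"
  shows "S north_pole = north_pole"
proof (rule north_pole_unique)
  show "S north_pole \<in> upper_hemisphere"
    using onto north_pole_in_upper_hemisphere by blast
  fix y :: "(real ^ 'n) \<times> real" assume "y \<in> upper_hemisphere"
  then obtain x where x: "x \<in> upper_hemisphere" "y = S x"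
    using onto by blast
  then have "inner (S north_pole) y = snd x"
    using iso[OF north_pole_in_upper_hemisphere x(1)]
    by (simp add: inner_commute[of north_pole] inner_north_pole)
  then show "inner (S north_pole) y \<ge> 0"
    using x by (simp add: upper_hemisphere_def)
qed

lemma nonexpansive_onto_hemisphere_preserves_polar_angle:
  fixes S :: "(real ^ 'n) \<times> real \<Rightarrow> (real ^ 'n) \<times> real"
  assumes onto: "S ` upper_hemisphere = upper_hemisphere"
    and nonexp: "\<And>x y. x \<in> upper_hemisphere \<Longrightarrow> y \<in> upper_hemisphere \<Longrightarrow>
      geodesic_dist (S x) (S y) \<le> geodesic_dist x y"
    and "x \<in> upper_hemisphere"
  shows "geodesic_dist (S x) north_pole = geodesic_dist x north_pole"
proof -
  have unit: "norm z = 1" "norm (S z) = 1" if "z \<in> upper_hemisphere" for z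
    using that onto by (auto simp: upper_hemisphere_def)
  have geod: "geodesic_dist (S u) (S v) = geodesic_dist u v"
    if u: "u \<in> upper_hemisphere" and v: "v \<in> upper_hemisphere" for u v
  proof -
    have "dist (S u) (S v) = dist u v"
    proof (rule nonexpansive_onto_compact_isometry[OF compact_upper_hemisphere onto _ u v])
      fix a b :: "(real ^ 'n) \<times> real"
      assume "a \<in> upper_hemisphere" "b \<in> upper_hemisphere"
      then show "dist (S a) (S b) \<le> dist a b"
        using nonexp[of a b] unit geodesic_dist_le_iff_dist_le[of "S a" "S b" a b] by simp
    qed
    then show ?thesis
      using unit[OF u] unit[OF v] geodesic_dist_le_iff_dist_le[of "S u" "S v" u v]
        geodesic_dist_le_iff_dist_le[of u v "S u" "S v"] by simp
  qed
  have "inner (S u) (S v) = inner u v" if u: "u \<in> upper_hemisphere" and v: "v \<in> upper_hemisphere"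
    for u v
    using geod[OF u v] unit[OF u] unit[OF v] arccos_eq_iff[of "inner (S u) (S v)" "inner u v"]
    by (simp add: geodesic_dist_def sphere_inner_bounds)
  then have "S north_pole = north_pole"
    using onto by (intro hemisphere_isometry_fixes_pole) auto
  then show ?thesis
    using geod[OF assms(3) north_pole_in_upper_hemisphere] by simp
qed

section \<open>The uniform measures\<close>

lemma sets_uniform_sphere: "sets uniform_sphere = sets (restrict_space borel (sphere 0 1))"
  unfolding uniform_sphere_def by (simp cong: sets_restrict_space_cong)

lemma space_uniform_sphere: "space uniform_sphere = sphere 0 1"
  unfolding uniform_sphere_def by (simp add: space_restrict_space)

lemma emeasure_uniform_sphere:
  fixes A :: "'a::euclidean_space set"
  assumes "A \<in> sets borel" "A \<subseteq> sphere 0 1"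
  shows "emeasure uniform_sphere A =
    emeasure lborel (ball 0 1 \<inter> sgn -` A) / emeasure lborel (ball 0 1 :: 'a set)"
proof -
  have [measurable]: "(sgn :: 'a \<Rightarrow> 'a) \<in> borel_measurable borel"
    unfolding sgn_div_norm by measurable
  have "emeasure uniform_sphere A = emeasure (uniform_measure lborel (ball 0 1)) (sgn -` A)"
    unfolding uniform_sphere_def
    using assms by (subst emeasure_restrict_space) (auto simp: emeasure_distr)
  also have "\<dots> = emeasure lborel (ball 0 1 \<inter> sgn -` A) / emeasure lborel (ball 0 1 :: 'a set)"
    using measurable_sets[of "sgn :: 'a \<Rightarrow> 'a" borel borel A] assms
    by (intro emeasure_uniform_measure) auto
  finally show ?thesis .
qed

lemma emeasure_lborel_open_pos:
  fixes U :: "'a::euclidean_space set"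
  assumes "open U" "a \<in> U"
  shows "emeasure lborel U \<noteq> 0"
proof
  assume "emeasure lborel U = 0"
  then have "U \<in> null_sets lborel"
    using assms(1) by (intro null_setsI) auto
  then have "negligible U"
    by (simp add: negligible_iff_null_sets null_sets_completionI)
  then show False
    using open_not_negligible assms by blast
qed

lemma emeasure_uniform_sphere_finite:
  "emeasure uniform_sphere (A :: 'a::euclidean_space set) \<noteq> \<infinity>"
proof -
  have ball: "emeasure lborel (ball 0 1 :: 'a set) \<noteq> \<infinity>" "emeasure lborel (ball 0 1 :: 'a set) \<noteq> 0"
    using emeasure_lborel_ball_finite[of "0::'a" 1] emeasure_lborel_open_pos[of "ball (0::'a) 1" 0]
    by auto
  have "emeasure uniform_sphere A \<le> emeasure uniform_sphere (sphere 0 1 :: 'a set)"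
    using emeasure_space[of uniform_sphere A] by (simp add: space_uniform_sphere)
  also have "\<dots> = emeasure lborel (ball 0 1 \<inter> sgn -` (sphere 0 1 :: 'a set)) /
      emeasure lborel (ball 0 1 :: 'a set)"
    by (rule emeasure_uniform_sphere) auto
  also have "\<dots> \<le> emeasure lborel (ball 0 1 :: 'a set) / emeasure lborel (ball 0 1 :: 'a set)"
    by (intro divide_right_mono_ennreal emeasure_mono) auto
  also have "\<dots> = 1"
    using ball by (intro ennreal_divide_self) (auto simp: less_top[symmetric])
  finally show ?thesis
    by (auto simp: top_unique)
qed

text \<open>
  The cone over a nonempty relatively open subset of the sphere contains a nonempty open set; the
  apex is removed because \<^const>\<open>sgn\<close> is discontinuous there.
\<close>

lemma emeasure_uniform_sphere_open_pos:
  fixes W :: "'a::euclidean_space set"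
  assumes "open W" "q \<in> W" "norm q = 1"
  shows "emeasure uniform_sphere (W \<inter> sphere 0 1) \<noteq> 0"
proof -
  define C where "C = (- {0} \<inter> sgn -` W) \<inter> ball (0::'a) 1"
  have [measurable]: "(sgn :: 'a \<Rightarrow> 'a) \<in> borel_measurable borel" "W \<in> sets borel"
    using assms(1) unfolding sgn_div_norm by measurable
  have "open C"
    unfolding C_def
    by (intro open_Int continuous_open_preimage continuous_intros) (use assms in auto)
  moreover have "q /\<^sub>R 2 \<in> C"
    using assms by (auto simp: C_def sgn_div_norm)
  ultimately have "emeasure lborel C \<noteq> 0"
    using emeasure_lborel_open_pos by blast
  moreover have "emeasure lborel C \<le> emeasure lborel (ball 0 1 \<inter> sgn -` (W \<inter> sphere 0 1))"
  proof (rule emeasure_mono)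
    show "C \<subseteq> ball 0 1 \<inter> sgn -` (W \<inter> sphere 0 1)"
      by (auto simp: C_def norm_sgn)
    have "sgn -` (W \<inter> sphere 0 1) \<inter> space borel \<in> sets (borel :: 'a measure)"
      by measurable
    then show "ball (0::'a) 1 \<inter> sgn -` (W \<inter> sphere 0 1) \<in> sets lborel"
      by auto
  qed
  ultimately have "emeasure lborel (ball 0 1 \<inter> sgn -` (W \<inter> sphere 0 1)) \<noteq> 0"
    by auto
  then show ?thesis
    using emeasure_lborel_ball_finite[of "0::'a" 1]
    by (subst emeasure_uniform_sphere) auto
qed

lemma sets_uniform_hemisphere:
  "sets uniform_hemisphere = sets (restrict_space borel (sphere 0 1))"
  by (simp add: uniform_hemisphere_def sets_uniform_sphere)

lemma space_uniform_hemisphere: "space uniform_hemisphere = sphere 0 1"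
  by (simp add: uniform_hemisphere_def space_uniform_sphere)

lemma upper_hemisphere_measurable:
  "(upper_hemisphere :: ((real ^ 'n) \<times> real) set) \<in> sets uniform_sphere"
proof -
  have "(upper_hemisphere :: ((real ^ 'n) \<times> real) set) \<in> sets borel"
    using compact_upper_hemisphere by (intro borel_closed compact_imp_closed)
  then show ?thesis
    by (auto simp: sets_uniform_sphere sets_restrict_space_iff upper_hemisphere_def)
qed

text \<open>
  A point of the equator has to be moved slightly towards the pole, so that a whole neighbourhood
  on the sphere lies in the hemisphere.
\<close>

lemma uniform_sphere_hemisphere_ball_pos:
  fixes p :: "(real ^ 'n) \<times> real"
  assumes "p \<in> upper_hemisphere" "r > 0"
  shows "emeasure uniform_sphere (upper_hemisphere \<inter> ball p r) \<noteq> 0"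
proof -
  have p: "norm p = 1" "snd p \<ge> 0"
    using assms(1) by (auto simp: upper_hemisphere_def)
  have "((\<lambda>e. sgn (p + e *\<^sub>R north_pole)) \<longlongrightarrow> sgn (p + 0 *\<^sub>R north_pole)) (at_right 0)"
    using p by (intro tendsto_intros) auto
  then have "\<forall>\<^sub>F e in at_right 0. sgn (p + e *\<^sub>R north_pole) \<in> ball p r"
    using p \<open>r > 0\<close> by (auto dest!: tendstoD simp: sgn_div_norm dist_commute)
  moreover have "\<forall>\<^sub>F e in at_right (0::real). e > 0"
    by (simp add: eventually_at_right_less)
  ultimately obtain e where e: "e > 0" "sgn (p + e *\<^sub>R north_pole) \<in> ball p r"
    using eventually_happens'[OF trivial_limit_at_right_real eventually_conj] by blast
  define q where "q = sgn (p + e *\<^sub>R north_pole)"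
  define W where "W = ball p r \<inter> {x. 0 < snd x}"
  have up: "snd (p + e *\<^sub>R north_pole) > 0"
    using e p by (simp add: north_pole_def)
  then have "p + e *\<^sub>R north_pole \<noteq> 0"
    by (metis less_irrefl snd_zero)
  then have q: "norm q = 1" "snd q > 0"
    using up unfolding q_def by (simp_all add: norm_sgn sgn_div_norm)
  have "open {x :: (real ^ 'n) \<times> real. 0 < snd x}"
    by (intro open_Collect_less continuous_intros)
  then have "emeasure uniform_sphere (W \<inter> sphere 0 1) \<noteq> 0"
    using e q by (intro emeasure_uniform_sphere_open_pos[of _ q]) (auto simp: W_def q_def)
  moreover have "emeasure uniform_sphere (W \<inter> sphere 0 1)
      \<le> emeasure uniform_sphere (upper_hemisphere \<inter> ball p r)"
  proof (rule emeasure_mono)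
    show "W \<inter> sphere 0 1 \<subseteq> upper_hemisphere \<inter> ball p r"
      by (auto simp: W_def upper_hemisphere_def)
    have "sphere 0 1 \<inter> ball p r \<in> sets (uniform_sphere :: ((real ^ 'n) \<times> real) measure)"
      by (auto simp: sets_uniform_sphere sets_restrict_space)
    then have "upper_hemisphere \<inter> (sphere 0 1 \<inter> ball p r) \<in> sets uniform_sphere"
      using upper_hemisphere_measurable by (rule sets.Int[rotated])
    then show "upper_hemisphere \<inter> ball p r \<in> sets uniform_sphere"
      by (rule back_subst[of "\<lambda>A. A \<in> sets uniform_sphere"]) (auto simp: upper_hemisphere_def)
  qed
  ultimately show ?thesis
    by auto
qed

lemma emeasure_upper_hemisphere_pos:
  "emeasure uniform_sphere (upper_hemisphere :: ((real ^ 'n) \<times> real) set) \<noteq> 0"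
proof -
  have "emeasure uniform_sphere (upper_hemisphere \<inter> ball (north_pole :: (real ^ 'n) \<times> real) 1)
      \<le> emeasure uniform_sphere (upper_hemisphere :: ((real ^ 'n) \<times> real) set)"
    using upper_hemisphere_measurable by (intro emeasure_mono) auto
  then show ?thesis
    using uniform_sphere_hemisphere_ball_pos[OF north_pole_in_upper_hemisphere, of 1] by auto
qed

lemma prob_space_uniform_hemisphere: "prob_space uniform_hemisphere"
  unfolding uniform_hemisphere_def
  using emeasure_upper_hemisphere_pos emeasure_uniform_sphere_finite
  by (rule prob_space_uniform_measure)

lemma AE_uniform_hemisphere: "AE x in uniform_hemisphere. x \<in> upper_hemisphere"
  unfolding uniform_hemisphere_def
  using upper_hemisphere_measurable by (intro AE_uniform_measureI) auto

lemma ball_measurable_uniform_hemisphere: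
  "upper_hemisphere \<inter> ball p r \<in> sets uniform_hemisphere"
proof -
  have "upper_hemisphere \<inter> ball p r \<in> sets borel"
    using compact_upper_hemisphere
    by (intro sets.Int borel_closed borel_open compact_imp_closed) auto
  then show ?thesis
    by (auto simp: sets_uniform_hemisphere sets_restrict_space_iff upper_hemisphere_def)
qed

lemma uniform_hemisphere_ball_pos:
  fixes p :: "(real ^ 'n) \<times> real"
  assumes "p \<in> upper_hemisphere" "r > 0"
  shows "emeasure uniform_hemisphere (upper_hemisphere \<inter> ball p r) \<noteq> 0"
proof -
  have "upper_hemisphere \<inter> ball p r \<in> sets uniform_sphere"
    using ball_measurable_uniform_hemisphere[of p r]
    by (simp add: sets_uniform_hemisphere sets_uniform_sphere)
  then have "emeasure uniform_hemisphere (upper_hemisphere \<inter> ball p r) =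
      emeasure uniform_sphere (upper_hemisphere \<inter> (upper_hemisphere \<inter> ball p r)) /
      emeasure uniform_sphere (upper_hemisphere :: ((real ^ 'n) \<times> real) set)"
    unfolding uniform_hemisphere_def
    using upper_hemisphere_measurable by (intro emeasure_uniform_measure)
  then show ?thesis
    using uniform_sphere_hemisphere_ball_pos[OF assms]
      emeasure_uniform_sphere_finite[of "upper_hemisphere :: ((real ^ 'n) \<times> real) set"]
    by (simp add: Int_assoc[symmetric])
qed

section \<open>Densities in the polar angle\<close>

lemma polar_angle_bounds:
  assumes "x \<in> sphere 0 1"
  shows "geodesic_dist x north_pole \<in> {0..pi}"
    and "geodesic_dist x north_pole \<le> pi / 2 \<longleftrightarrow> x \<in> upper_hemisphere"
proof -
  have x: "\<bar>snd x\<bar> \<le> 1"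
    using assms norm_snd_le[of "snd x" "fst x"] by simp
  then show "geodesic_dist x north_pole \<in> {0..pi}"
    using arccos_bounded[of "snd x"] by (auto simp: geodesic_dist_def inner_north_pole)
  show "geodesic_dist x north_pole \<le> pi / 2 \<longleftrightarrow> x \<in> upper_hemisphere"
    using arccos_le_mono[of "snd x" 0] x assms
    by (auto simp: geodesic_dist_def inner_north_pole upper_hemisphere_def)
qed

lemma measurable_id_sphere:
  assumes "sets M = sets (restrict_space borel (sphere 0 1))"
  shows "(\<lambda>x. x) \<in> borel_measurable M"
  unfolding measurable_cong_sets[OF assms refl]
  by (rule measurable_restrict_space1) simp

text \<open>
  Off \<open>[-1,1]\<close> the value of \<^const>\<open>arccos\<close> is unspecified, so its argument is clipped.
\<close>

lemma geodesic_dist_measurable: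
  fixes X Y :: "'a \<Rightarrow> 'b::euclidean_space"
  assumes [measurable]: "X \<in> borel_measurable M" "Y \<in> borel_measurable M"
    and unit: "\<And>x. x \<in> space M \<Longrightarrow> norm (X x) = 1 \<and> norm (Y x) = 1"
  shows "(\<lambda>x. geodesic_dist (X x) (Y x)) \<in> borel_measurable M"
proof -
  have "(\<lambda>t :: real. arccos (max (- 1) (min 1 t))) \<in> borel_measurable borel"
    by (intro borel_measurable_continuous_onI continuous_intros) auto
  then have "(\<lambda>x. arccos (max (- 1) (min 1 (inner (X x) (Y x))))) \<in> borel_measurable M"
    by (rule measurable_compose[rotated]) measurable
  moreover have "arccos (max (- 1) (min 1 (inner (X x) (Y x)))) = geodesic_dist (X x) (Y x)"
    if "x \<in> space M" for x
    using sphere_inner_bounds[of "X x" "Y x"] unit[OF that]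
    by (simp add: geodesic_dist_def abs_le_iff min_absorb2 max_absorb2)
  ultimately show ?thesis
    by (simp cong: measurable_cong)
qed

lemma polar_angle_measurable:
  "(\<lambda>x. geodesic_dist x north_pole) \<in> borel_measurable uniform_hemisphere"
  using north_pole_in_upper_hemisphere
  by (intro geodesic_dist_measurable measurable_id_sphere sets_uniform_hemisphere)
    (auto simp: space_uniform_hemisphere upper_hemisphere_def)

text \<open>
  The image of the measure with density \<open>\<phi> \<circ> h\<close> has density \<open>\<phi>\<close> with respect to the image of
  \<open>M\<close>, and densities are unique almost everywhere; so \<open>\<phi> \<circ> h = 1\<close> almost
  everywhere.
\<close>

lemma density_comp_eq_if_distr_eq:
  fixes h :: "'a \<Rightarrow> 'b" and \<phi> :: "'b \<Rightarrow> ennreal"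
  assumes "prob_space M" and h: "h \<in> measurable M N" and \<phi>: "\<phi> \<in> borel_measurable N"
    and eq: "distr (density M (\<lambda>x. \<phi> (h x))) N h = distr M N h"
  shows "density M (\<lambda>x. \<phi> (h x)) = M"
proof -
  interpret image: prob_space "distr M N h"
    using assms(1) h by (rule prob_space.prob_space_distr)
  have "density (distr M N h) \<phi> = density (distr M N h) (\<lambda>_. 1)"
    using eq by (simp add: density_distr[OF \<phi> h] density_1)
  then have "AE t in distr M N h. \<phi> t = 1"
    using \<phi> by (intro image.density_unique) auto
  then have "AE x in M. \<phi> (h x) = 1"
    using h by (rule AE_distrD[rotated])
  then have "density M (\<lambda>x. \<phi> (h x)) = density M (\<lambda>_. 1)"
    using h \<phi> by (intro density_cong) (auto intro: measurable_compose)
  then show ?thesis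
    by (simp add: density_1)
qed

section \<open>Transport maps\<close>

text \<open>
  A point missed by the compact image of \<open>S\<close> has a neighbourhood that is missed as well, so
  almost no mass is sent there, against the positivity of the target measure.
\<close>

lemma map_onto_hemisphere_if_positive_density:
  fixes S T :: "(real ^ 'n) \<times> real \<Rightarrow> (real ^ 'n) \<times> real"
  assumes S: "S \<in> upper_hemisphere \<rightarrow> upper_hemisphere"
    and cont: "continuous_on upper_hemisphere S"
    and TS: "AE x in uniform_hemisphere. T x = S x"
    and T: "T \<in> measurable uniform_hemisphere (density uniform_hemisphere g)"
    and push: "distr uniform_hemisphere (density uniform_hemisphere g) T
      = density uniform_hemisphere g"
    and g: "g \<in> borel_measurable uniform_hemisphere"
    and pos: "\<And>x. x \<in> upper_hemisphere \<Longrightarrow> g x > 0"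
  shows "S ` upper_hemisphere = upper_hemisphere"
proof (intro equalityI subsetI)
  show "y \<in> upper_hemisphere" if "y \<in> S ` upper_hemisphere" for y
    using S that by auto
  fix p :: "(real ^ 'n) \<times> real" assume p: "p \<in> upper_hemisphere"
  show "p \<in> S ` upper_hemisphere"
  proof (rule ccontr)
    assume "p \<notin> S ` upper_hemisphere"
    moreover have "closed (S ` upper_hemisphere)"
      using compact_continuous_image[OF cont compact_upper_hemisphere] by (rule compact_imp_closed)
    ultimately obtain r where r: "r > 0" "ball p r \<inter> S ` upper_hemisphere = {}"
      using open_contains_ball[of "- S ` upper_hemisphere"] by (auto simp: open_Compl) blast
    define U where "U = upper_hemisphere \<inter> ball p r"
    have U: "U \<in> sets uniform_hemisphere"
      unfolding U_def by (rule ball_measurable_uniform_hemisphere)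
    have "AE x in uniform_hemisphere. T x \<notin> U"
      using TS AE_uniform_hemisphere
    proof eventually_elim
      case (elim x)
      then show ?case
        using r by (auto simp: U_def)
    qed
    then have "AE y in distr uniform_hemisphere (density uniform_hemisphere g) T. y \<notin> U"
      using T U by (subst AE_distr_iff) (auto intro: pred_sets2)
    then have "AE y in uniform_hemisphere. g y > 0 \<longrightarrow> y \<notin> U"
      unfolding push using g by (simp add: AE_density)
    then have "AE y in uniform_hemisphere. y \<notin> U"
      by eventually_elim (use pos in \<open>auto simp: U_def\<close>)
    then have "emeasure uniform_hemisphere U = 0"
      using U by (simp add: AE_iff_null_sets null_setsD1)
    then show False
      using uniform_hemisphere_ball_pos[OF p r(1)] by (simp add: U_def)
  qed
qed

text \<open>
  The diagonal coupling, which leaves every point in place, has cost \<open>0\<close>.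
\<close>

lemma W2_squared_self:
  fixes \<mu> :: "'a::euclidean_space measure"
  assumes sets: "sets \<mu> = sets (restrict_space borel (sphere 0 1))"
  shows "W2_squared \<mu> \<mu> = 0"
proof -
  have space: "space \<mu> = sphere 0 1"
    using sets_eq_imp_space_eq[OF sets] by (simp add: space_restrict_space)
  define \<pi> where "\<pi> = distr \<mu> (\<mu> \<Otimes>\<^sub>M \<mu>) (\<lambda>x. (x, x))"
  have "\<pi> \<in> couplings \<mu> \<mu>"
    by (simp add: couplings_def \<pi>_def distr_distr comp_def)
  then have "W2_squared \<mu> \<mu> \<le> (\<integral>\<^sup>+(x, y). ennreal ((geodesic_dist x y)\<^sup>2) \<partial>\<pi>)"
    unfolding W2_squared_def by (rule INF_lower)
  also have "\<dots> = (\<integral>\<^sup>+x. ennreal ((geodesic_dist x x)\<^sup>2) \<partial>\<mu>)"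
  proof -
    have "(\<lambda>z. geodesic_dist (fst z) (snd z)) \<in> borel_measurable (\<mu> \<Otimes>\<^sub>M \<mu>)"
      using measurable_compose[OF measurable_fst measurable_id_sphere[OF sets]]
        measurable_compose[OF measurable_snd measurable_id_sphere[OF sets]]
      by (rule geodesic_dist_measurable) (auto simp: space_pair_measure space)
    then show ?thesis
      unfolding \<pi>_def by (subst nn_integral_distr) (auto simp: case_prod_beta)
  qed
  also have "\<dots> = (\<integral>\<^sup>+x. 0 \<partial>\<mu>)"
    by (rule nn_integral_cong) (simp add: space geodesic_dist_eq_0_iff)
  finally show ?thesis
    by simp
qed

lemma optimal_transport_map_self_AE_id:
  fixes T :: "(real ^ 'n) \<times> real \<Rightarrow> (real ^ 'n) \<times> real"
  assumes "optimal_transport_map uniform_hemisphere uniform_hemisphere T"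
  shows "AE x in uniform_hemisphere. T x = x"
proof -
  have T: "T \<in> measurable uniform_hemisphere uniform_hemisphere"
    and "(\<integral>\<^sup>+x. ennreal ((geodesic_dist x (T x))\<^sup>2) \<partial>uniform_hemisphere) = 0"
    using assms
    by (simp_all add: optimal_transport_map_def W2_squared_self sets_uniform_hemisphere)
  moreover have "(\<lambda>x. geodesic_dist x (T x)) \<in> borel_measurable uniform_hemisphere"
    using measurable_id_sphere[OF sets_uniform_hemisphere]
      measurable_compose[OF T measurable_id_sphere[OF sets_uniform_hemisphere]]
    by (rule geodesic_dist_measurable)
      (use measurable_space[OF T] in \<open>simp add: space_uniform_hemisphere\<close>)
  ultimately have "AE x in uniform_hemisphere. geodesic_dist x (T x) = 0"
    by (subst (asm) nn_integral_0_iff_AE) auto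
  with AE_space show ?thesis
  proof eventually_elim
    case (elim x)
    then show ?case
      using measurable_space[OF T, of x] geodesic_dist_eq_0_iff[of x "T x"]
      by (simp add: space_uniform_hemisphere)
  qed
qed

theorem proposition2:
  fixes f :: "real \<Rightarrow> real"
    and \<nu> :: "((real ^ 'n) \<times> real) measure"
    and T :: "(real ^ 'n) \<times> real \<Rightarrow> (real ^ 'n) \<times> real"
  assumes "CARD('n) \<ge> 2"
    and "continuous_on {0..pi/2} f"
    and "\<And>t. t \<in> {0..pi/2} \<Longrightarrow> f t > 0"
    and "prob_space \<nu>"
    and "\<nu> = density uniform_hemisphere
               (\<lambda>x. ennreal (f (geodesic_dist x north_pole)) * indicator upper_hemisphere x)"
    and "optimal_transport_map uniform_hemisphere \<nu> T"
  shows "ae_1_lipschitz T \<longleftrightarrow> \<nu> = uniform_hemisphere"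
proof
  assume "\<nu> = uniform_hemisphere"
  then have "AE x in uniform_hemisphere. T x = x"
    using assms(6) by (intro optimal_transport_map_self_AE_id) simp
  then show "ae_1_lipschitz T"
    unfolding ae_1_lipschitz_def by (intro exI[of _ "\<lambda>x. x"]) auto
next
  let ?\<sigma> = "uniform_hemisphere :: ((real ^ 'n) \<times> real) measure"
  let ?h = "\<lambda>x :: (real ^ 'n) \<times> real. geodesic_dist x north_pole"
  \<comment> \<open>Extending \<open>f\<close> by \<open>0\<close> absorbs the indicator of the hemisphere into a function of \<open>h\<close>.\<close>
  define \<phi> where "\<phi> t = ennreal (indicator {0..pi/2} t *\<^sub>R f t)" for t
  have \<phi>: "\<phi> \<in> borel_measurable borel"
    unfolding \<phi>_def using assms(2)
    by (intro measurable_compose[OF borel_measurable_continuous_on_indicator]) auto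
  have h: "?h \<in> borel_measurable ?\<sigma>"
    by (rule polar_angle_measurable)
  have \<phi>h: "(\<lambda>x. \<phi> (?h x)) \<in> borel_measurable ?\<sigma>"
    by (rule measurable_compose[OF h \<phi>])
  have weight: "\<phi> (?h x) = ennreal (f (?h x)) * indicator upper_hemisphere x"
    if "x \<in> space ?\<sigma>" for x
    using polar_angle_bounds[of x] that
    by (auto simp: \<phi>_def space_uniform_hemisphere split: split_indicator)
  have \<nu>: "\<nu> = density ?\<sigma> (\<lambda>x. \<phi> (?h x))"
  proof -
    have "(\<lambda>x. ennreal (f (?h x)) * indicator upper_hemisphere x) \<in> borel_measurable ?\<sigma>"
      using \<phi>h by (simp add: weight cong: measurable_cong)
    then show ?thesis
      unfolding assms(5) using \<phi>h weight by (intro density_cong) auto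
  qed
  have T: "T \<in> measurable ?\<sigma> \<nu>" and push: "distr ?\<sigma> \<nu> T = \<nu>"
    using assms(6) by (auto simp: optimal_transport_map_def)
  assume "ae_1_lipschitz T"
  then obtain S where S: "S \<in> upper_hemisphere \<rightarrow> upper_hemisphere"
    and lip: "\<And>x y. x \<in> upper_hemisphere \<Longrightarrow> y \<in> upper_hemisphere \<Longrightarrow>
      geodesic_dist (S x) (S y) \<le> geodesic_dist x y"
    and TS: "AE x in ?\<sigma>. T x = S x"
    unfolding ae_1_lipschitz_def by blast
  have unit: "norm x = 1" "norm (S x) = 1" if "x \<in> upper_hemisphere" for x
    using S that by (auto simp: upper_hemisphere_def)
  have "1-lipschitz_on upper_hemisphere S"
  proof (rule lipschitz_onI)
    fix x y :: "(real ^ 'n) \<times> real"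
    assume xy: "x \<in> upper_hemisphere" "y \<in> upper_hemisphere"
    then show "dist (S x) (S y) \<le> 1 * dist x y"
      using lip[OF xy] unit geodesic_dist_le_iff_dist_le[of "S x" "S y" x y] by simp
  qed simp
  then have "continuous_on upper_hemisphere S"
    by (rule lipschitz_on_continuous_on)
  then have onto: "S ` upper_hemisphere = upper_hemisphere"
  proof (rule map_onto_hemisphere_if_positive_density[OF S _ TS T[unfolded \<nu>] push[unfolded \<nu>] \<phi>h])
    fix x :: "(real ^ 'n) \<times> real" assume x: "x \<in> upper_hemisphere"
    then have "x \<in> sphere 0 1"
      by (simp add: upper_hemisphere_def)
    then show "\<phi> (?h x) > 0"
      using polar_angle_bounds[of x] assms(3)[of "?h x"] x by (simp add: \<phi>_def)
  qed
  have h\<nu>: "?h \<in> borel_measurable \<nu>"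
    unfolding \<nu> using h by simp
  have "AE x in ?\<sigma>. ?h (T x) = ?h x"
    using TS AE_uniform_hemisphere
  proof eventually_elim
    case (elim x)
    then show ?case
      using nonexpansive_onto_hemisphere_preserves_polar_angle[OF onto lip] by simp
  qed
  then have "distr ?\<sigma> borel (\<lambda>x. ?h (T x)) = distr ?\<sigma> borel ?h"
    using h measurable_compose[OF T h\<nu>] by (intro distr_cong_AE) auto
  then have "distr \<nu> borel ?h = distr ?\<sigma> borel ?h"
    using distr_distr[OF h\<nu> T] push by (simp add: comp_def)
  then show "\<nu> = ?\<sigma>"
    unfolding \<nu> by (rule density_comp_eq_if_distr_eq[OF prob_space_uniform_hemisphere h \<phi>])
qed

end
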